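(* Consider a stopping problem as described in the context, with finite horizon $N$. Let $S$ and $T$ be information structures with $S\succsim T$. Denote by $V^N_n(\mu)$ and $U^N_n(\mu)$ the period-$n$ value functions when the decision maker receives information from $S$ and $T$, respectively. Then: (1) for every period $n\in\{0,\dots,N\}$, $V^N_n(\mu)\ge U^N_n(\mu)$ for all $\mu\in\Delta\Theta$; (2) for every period $n\in\{0,\dots,N\}$, $A^N_n(T)\subseteq A^N_n(S)$ and $E^N_n(S)\subseteq E^N_n(T)$.
   Context: Setting. A decision maker faces a stopping problem with periods $n=0,1,\dots,N$ and an unknown time-invariant state $\theta\in\Theta=\{\theta_1,\dots,\theta_m\}$, $m\ge2$. $\Delta\Theta$ is the set of probability distributions on $\Theta$. $A$ is a nonempty compact action set; $u:A\times\Theta\to\mathbb{R}$ is bounded and continuous in $a$ for every $\theta$; $\pi(\mu):=\max_{a\in A}\sum_{\theta}u(a,\theta)\mu_\theta$ is the stopping payoff at belief $\mu$. The discount factor is $\delta\in(0,1]$. Waiting beyond period $N$ gives payoff $0$. Information. An information structure $S$ consists of a finite signal set and, for each $\theta$, a probability distribution $f_\theta$ on it; it is identified with the stochastic matrix with rows indexed by $\theta$, columns by signals, and entries $f_\theta(s)$. Given belief $\mu$, signal $s$ has probability $\alpha_s(\mu)=\sum_\theta\mu_\theta f_\theta(s)$ and, if this is positive, the posterior is $\mu(s)=(\mu_\theta f_\theta(s)/\alpha_s(\mu))_\theta$. $\mathbb{E}(g(\mu(s))\mid\mu)=\sum_s\alpha_s(\mu)g(\mu(s))$. We write $S\succsim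 T$ ($S$ is more informative than $T$ in the sense of Blackwell) if there is a stochastic matrix $M$ with $SM=T$. Value functions and sets. Only upfront fee schemes are considered, so no fees are charged after period $0$, and the value functions do not account for the upfront fee. Under $S$: $V^N_N(\mu)=\max\{\pi(\mu),0\}$ and $V^N_n(\mu)=\max\{\pi(\mu),\delta\,\mathbb{E}(V^N_{n+1}(\mu(s))\mid\mu)\}$ for $0\le n\le N-1$; the stopping sets are $E^N_n(S)=\{\mu\in\Delta\Theta:V^N_n(\mu)=\pi(\mu)\}$ and the information acquisition sets are $A^N_n(S)=\Delta\Theta\setminus E^N_n(S)$. The functions $U^N_n$ and the sets $E^N_n(T)$, $A^N_n(T)$ are defined in the same way using $T$. *)

theory Defs
  imports "HOL-Analysis.Analysis"
begin

text \<open>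
  The states are the elements of a finite type \<open>'th\<close>; beliefs are vectors indexed by
  states, and an information structure is a row-stochastic matrix with rows indexed by states and
  columns by the elements of a finite signal type.
\<close>

definition beliefs :: "(real ^ 'th::finite) set" where
  "beliefs = {\<mu>. (\<forall>\<theta>. 0 \<le> \<mu> $ \<theta>) \<and> (\<Sum>\<theta>\<in>UNIV. \<mu> $ \<theta>) = 1}"

definition stochastic :: "real ^ 'c::finite ^ 'r::finite \<Rightarrow> bool" where
  "stochastic P \<longleftrightarrow> (\<forall>i j. 0 \<le> P $ i $ j) \<and> (\<forall>i. (\<Sum>j\<in>UNIV. P $ i $ j) = 1)"

definition more_informative ::
  "real ^ 's::finite ^ 'th::finite \<Rightarrow> real ^ 't::finite ^ 'th \<Rightarrow> bool" where
  "more_informative S T \<longleftrightarrow> (\<exists>M. stochastic M \<and> S ** M = T)"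

definition signal_prob :: "real ^ 's::finite ^ 'th::finite \<Rightarrow> real ^ 'th \<Rightarrow> 's \<Rightarrow> real" where
  "signal_prob S \<mu> s = (\<Sum>\<theta>\<in>UNIV. \<mu> $ \<theta> * S $ \<theta> $ s)"

text \<open>
  A signal of probability zero gets the junk posterior \<open>0\<close> (division by zero); its
  weight in \<open>expect_posterior\<close> is zero, so this value plays no role.
\<close>

definition posterior :: "real ^ 's::finite ^ 'th::finite \<Rightarrow> real ^ 'th \<Rightarrow> 's \<Rightarrow> real ^ 'th" where
  "posterior S \<mu> s = (\<chi> \<theta>. \<mu> $ \<theta> * S $ \<theta> $ s / signal_prob S \<mu> s)"

definition expect_posterior ::
  "real ^ 's::finite ^ 'th::finite \<Rightarrow> (real ^ 'th \<Rightarrow> real) \<Rightarrow> real ^ 'th \<Rightarrow> real" where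
  "expect_posterior S g \<mu> = (\<Sum>s\<in>UNIV. signal_prob S \<mu> s * g (posterior S \<mu> s))"

definition stop_payoff :: "'a set \<Rightarrow> ('a \<Rightarrow> 'th::finite \<Rightarrow> real) \<Rightarrow> real ^ 'th \<Rightarrow> real" where
  "stop_payoff A u \<mu> = (SUP a\<in>A. \<Sum>\<theta>\<in>UNIV. u a \<theta> * \<mu> $ \<theta>)"

text \<open>
  For a compact action set and continuous utilities, the supremum in \<open>stop_payoff\<close> is a maximum.
\<close>

lemma stop_payoff_is_max:
  fixes A :: "'a::topological_space set" and u :: "'a \<Rightarrow> 'th::finite \<Rightarrow> real"
  assumes "A \<noteq> {}" "compact A" "\<And>\<theta>. continuous_on A (\<lambda>a. u a \<theta>)"
  shows "\<exists>a\<in>A. stop_payoff A u \<mu> = (\<Sum>\<theta>\<in>UNIV. u a \<theta> * \<mu> $ \<theta>) \<and>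
    (\<forall>b\<in>A. (\<Sum>\<theta>\<in>UNIV. u b \<theta> * \<mu> $ \<theta>) \<le> stop_payoff A u \<mu>)"
proof -
  let ?f = "\<lambda>a. \<Sum>\<theta>\<in>UNIV. u a \<theta> * \<mu> $ \<theta>"
  have "continuous_on A ?f"
    by (intro continuous_intros assms(3))
  then obtain a where a: "a \<in> A" "\<forall>b\<in>A. ?f b \<le> ?f a"
    using continuous_attains_sup[OF assms(2,1)] by blast
  have "stop_payoff A u \<mu> = ?f a"
    unfolding stop_payoff_def using a by (intro cSup_eq_maximum) auto
  with a show ?thesis by auto
qed

text \<open>
  Period-\<open>n\<close> value function with horizon \<open>N\<close>; only \<open>n \<le> N\<close> is meaningful, and the
  last branch is the one for \<open>n = N\<close>.
\<close>

function value_fn :: "'a set \<Rightarrow> ('a \<Rightarrow> 'th::finite \<Rightarrow> real) \<Rightarrow> real \<Rightarrow> real ^ 's::finite ^ 'th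
    \<Rightarrow> nat \<Rightarrow> nat \<Rightarrow> real ^ 'th \<Rightarrow> real" where
  "value_fn A u \<delta> S N n =
    (if n < N
     then (\<lambda>\<mu>. max (stop_payoff A u \<mu>)
                    (\<delta> * expect_posterior S (value_fn A u \<delta> S N (Suc n)) \<mu>))
     else (\<lambda>\<mu>. max (stop_payoff A u \<mu>) 0))"
  by pat_completeness auto
termination
  by (relation "Wellfounded.measure (\<lambda>(A, u, \<delta>, S, N, n). N - n)") auto

declare value_fn.simps [simp del]

definition stop_set :: "'a set \<Rightarrow> ('a \<Rightarrow> 'th::finite \<Rightarrow> real) \<Rightarrow> real \<Rightarrow> real ^ 's::finite ^ 'th
    \<Rightarrow> nat \<Rightarrow> nat \<Rightarrow> (real ^ 'th) set" where
  "stop_set A u \<delta> S N n = {\<mu> \<in> beliefs. value_fn A u \<delta> S N n \<mu> = stop_payoff A u \<mu>}"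

definition acquire_set :: "'a set \<Rightarrow> ('a \<Rightarrow> 'th::finite \<Rightarrow> real) \<Rightarrow> real \<Rightarrow> real ^ 's::finite ^ 'th
    \<Rightarrow> nat \<Rightarrow> nat \<Rightarrow> (real ^ 'th) set" where
  "acquire_set A u \<delta> S N n = beliefs - stop_set A u \<delta> S N n"

end

theory Submission
  imports Defs
begin

text \<open>
  All functions involved are positively homogeneous on the nonnegative orthant, which makes the
  normalisation of posteriors irrelevant: for homogeneous \<open>g\<close>, the expectation of \<open>g\<close> over
  posteriors is \<open>\<Sum>s. g (\<mu>\<^sub>\<theta> f\<^sub>\<theta>(s))\<^sub>\<theta>\<close>. In this form the operator
  preserves sublinearity, so every value function is sublinear. If \<open>SM = T\<close>, the unnormalised
  posteriors of \<open>T\<close> are the \<open>M\<close>-weighted sums of those of \<open>S\<close>, and sublinearity together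
  with the unit row sums of \<open>M\<close> shows that \<open>S\<close> yields the larger expectation. Backward
  induction on the period concludes.
\<close>

text \<open>The orthant is the right domain: unnormalised posteriors leave the simplex but stay
  here, while with mixed signs a signal probability could vanish by cancellation. Allowing
  \<open>c = 0\<close> forces the value 0 at the origin.\<close>

definition sublinear_on_orthant :: "(real ^ 'n::finite \<Rightarrow> real) \<Rightarrow> bool" where
  "sublinear_on_orthant g \<longleftrightarrow>
    (\<forall>c x. 0 \<le> c \<longrightarrow> 0 \<le> x \<longrightarrow> g (c *\<^sub>R x) = c * g x) \<and>
    (\<forall>x y. 0 \<le> x \<longrightarrow> 0 \<le> y \<longrightarrow> g (x + y) \<le> g x + g y)"

lemma sublinear_on_orthant_scaleR:
  "sublinear_on_orthant g \<Longrightarrow> 0 \<le> c \<Longrightarrow> 0 \<le> x \<Longrightarrow> g (c *\<^sub>R x) = c * g x"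
  by (simp add: sublinear_on_orthant_def)

lemma sublinear_on_orthant_add:
  "sublinear_on_orthant g \<Longrightarrow> 0 \<le> x \<Longrightarrow> 0 \<le> y \<Longrightarrow> g (x + y) \<le> g x + g y"
  by (simp add: sublinear_on_orthant_def)

lemma sublinear_on_orthant_zero:
  assumes "sublinear_on_orthant g"
  shows "g 0 = 0"
  using sublinear_on_orthant_scaleR[OF assms, of 0 0] by simp

lemma sublinear_on_orthant_sum:
  assumes g: "sublinear_on_orthant g" and "finite I" and x: "\<And>i. i \<in> I \<Longrightarrow> 0 \<le> x i"
  shows "g (\<Sum>i\<in>I. x i) \<le> (\<Sum>i\<in>I. g (x i))"
  using \<open>finite I\<close> x
proof (induction I rule: finite_induct)
  case empty
  then show ?case by (simp add: sublinear_on_orthant_zero[OF g])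
next
  case (insert i I)
  then have "g (x i + (\<Sum>i\<in>I. x i)) \<le> g (x i) + g (\<Sum>i\<in>I. x i)"
    by (intro sublinear_on_orthant_add[OF g] sum_nonneg) auto
  also have "g (\<Sum>i\<in>I. x i) \<le> (\<Sum>i\<in>I. g (x i))"
    using insert by auto
  finally show ?case using insert.hyps by simp
qed

lemma sublinear_on_orthant_const_zero: "sublinear_on_orthant (\<lambda>_. 0)"
  by (simp add: sublinear_on_orthant_def)

lemma sublinear_on_orthant_max:
  assumes "sublinear_on_orthant g" "sublinear_on_orthant h"
  shows "sublinear_on_orthant (\<lambda>x. max (g x) (h x))"
  unfolding sublinear_on_orthant_def
proof (intro conjI allI impI)
  fix c :: real and x :: "real ^ 'a" assume "0 \<le> c" "0 \<le> x"
  then show "max (g (c *\<^sub>R x)) (h (c *\<^sub>R x)) = c * max (g x) (h x)"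
    using assms by (simp add: sublinear_on_orthant_scaleR max_mult_distrib_left)
next
  fix x y :: "real ^ 'a" assume "0 \<le> x" "0 \<le> y"
  then have "g (x + y) \<le> g x + g y" "h (x + y) \<le> h x + h y"
    using assms by (simp_all add: sublinear_on_orthant_add)
  then show "max (g (x + y)) (h (x + y)) \<le> max (g x) (h x) + max (g y) (h y)"
    by linarith
qed

lemma sublinear_on_orthant_cmult:
  assumes "sublinear_on_orthant g" "0 \<le> d"
  shows "sublinear_on_orthant (\<lambda>x. d * g x)"
  using assms unfolding sublinear_on_orthant_def
  by (auto simp: distrib_left[symmetric] intro: mult_left_mono)

text \<open>A pointwise maximum of linear functionals is sublinear; compactness supplies the
  maximisers that are compared below.\<close>

lemma sublinear_on_orthant_stop_payoff:
  fixes A :: "'a::topological_space set" and u :: "'a \<Rightarrow> 'th::finite \<Rightarrow> real"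
  assumes "A \<noteq> {}" "compact A" "\<And>\<theta>. continuous_on A (\<lambda>a. u a \<theta>)"
  shows "sublinear_on_orthant (stop_payoff A u)"
  unfolding sublinear_on_orthant_def
proof (intro conjI allI impI)
  let ?f = "\<lambda>\<mu> a. \<Sum>\<theta>\<in>UNIV. u a \<theta> * \<mu> $ \<theta>"
  note is_max = stop_payoff_is_max[where u = u, OF assms]
  fix c :: real and x :: "real ^ 'th" assume c: "0 \<le> c"
  have scale: "?f (c *\<^sub>R x) a = c * ?f x a" for a
    by (simp add: sum_distrib_left mult_ac)
  obtain a where a: "a \<in> A" "stop_payoff A u (c *\<^sub>R x) = ?f (c *\<^sub>R x) a"
      "\<And>b. b \<in> A \<Longrightarrow> ?f (c *\<^sub>R x) b \<le> stop_payoff A u (c *\<^sub>R x)"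
    using is_max[of "c *\<^sub>R x"] by blast
  obtain b where b: "b \<in> A" "stop_payoff A u x = ?f x b"
      "\<And>b. b \<in> A \<Longrightarrow> ?f x b \<le> stop_payoff A u x"
    using is_max[of x] by blast
  show "stop_payoff A u (c *\<^sub>R x) = c * stop_payoff A u x"
  \<comment> \<open>Each maximiser competes in the other problem: \<open>a\<close> at
    \<open>x\<close>, and \<open>b\<close> at \<open>c *\<^sub>R x\<close>.\<close>
  proof (rule antisym)
    show "stop_payoff A u (c *\<^sub>R x) \<le> c * stop_payoff A u x"
      unfolding a(2) scale by (rule mult_left_mono[OF b(3)[OF a(1)] c])
    show "c * stop_payoff A u x \<le> stop_payoff A u (c *\<^sub>R x)"
      unfolding b(2) scale[symmetric] by (rule a(3)[OF b(1)])
  qed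
next
  let ?f = "\<lambda>\<mu> a. \<Sum>\<theta>\<in>UNIV. u a \<theta> * \<mu> $ \<theta>"
  note is_max = stop_payoff_is_max[where u = u, OF assms]
  fix x y :: "real ^ 'th"
  obtain a where a: "a \<in> A" "stop_payoff A u (x + y) = ?f (x + y) a"
    using is_max[of "x + y"] by blast
  have "?f (x + y) a = ?f x a + ?f y a"
    by (simp add: distrib_left sum.distrib)
  \<comment> \<open>The joint maximiser \<open>a\<close> is merely one feasible action at
    \<open>x\<close> and at \<open>y\<close>.\<close>
  also have "\<dots> \<le> stop_payoff A u x + stop_payoff A u y"
    using is_max[of x] is_max[of y] a(1) by (intro add_mono) blast+
  finally show "stop_payoff A u (x + y) \<le> stop_payoff A u x + stop_payoff A u y"
    by (simp only: a(2))
qed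

text \<open>The posterior before division by the signal probability. Unlike the posterior, it is
  linear in \<open>\<mu>\<close>.\<close>

definition joint :: "real ^ 's::finite ^ 'th::finite \<Rightarrow> real ^ 'th \<Rightarrow> 's \<Rightarrow> real ^ 'th" where
  "joint S \<mu> s = (\<chi> \<theta>. \<mu> $ \<theta> * S $ \<theta> $ s)"

lemma joint_nonneg: "stochastic S \<Longrightarrow> 0 \<le> \<mu> \<Longrightarrow> 0 \<le> joint S \<mu> s"
  by (simp add: joint_def stochastic_def less_eq_vec_def)

lemma joint_scaleR: "joint S (c *\<^sub>R \<mu>) s = c *\<^sub>R joint S \<mu> s"
  by (simp add: joint_def vec_eq_iff)

lemma joint_add: "joint S (\<mu> + \<nu>) s = joint S \<mu> s + joint S \<nu> s"
  by (simp add: joint_def vec_eq_iff distrib_right)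

text \<open>Garbling draws \<open>t\<close> from \<open>s\<close> with probability
  \<open>M $ s $ t\<close> whatever the state, so the same weights apply to every
  coordinate.\<close>

lemma joint_matrix_mult: "joint (S ** M) \<mu> t = (\<Sum>s\<in>UNIV. M $ s $ t *\<^sub>R joint S \<mu> s)"
  by (simp add: joint_def vec_eq_iff matrix_matrix_mult_def sum_distrib_left mult_ac)

text \<open>Homogeneity moves the weight of a signal inside \<open>g\<close>, where it cancels the
  denominator of the posterior.\<close>

lemma expect_posterior_eq_sum_joint:
  assumes g: "sublinear_on_orthant g" and S: "stochastic S" and \<mu>: "0 \<le> \<mu>"
  shows "expect_posterior S g \<mu> = (\<Sum>s\<in>UNIV. g (joint S \<mu> s))"
  unfolding expect_posterior_def
proof (rule sum.cong[OF refl])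
  fix s
  let ?p = "signal_prob S \<mu> s"
  have nonneg: "0 \<le> \<mu> $ \<theta> * S $ \<theta> $ s" for \<theta>
    using S \<mu> by (simp add: stochastic_def less_eq_vec_def)
  have p: "0 \<le> ?p"
    unfolding signal_prob_def by (rule sum_nonneg) (rule nonneg)
  have post: "0 \<le> posterior S \<mu> s"
    using nonneg p by (simp add: posterior_def less_eq_vec_def)
  have "?p *\<^sub>R posterior S \<mu> s = joint S \<mu> s"
  proof (cases "?p = 0")
    case True
    \<comment> \<open>Nonnegative terms with sum zero all vanish, so \<open>joint\<close> is the
      zero vector and agrees with zero times the junk posterior.\<close>
    then have "\<mu> $ \<theta> * S $ \<theta> $ s = 0" for \<theta>
      unfolding signal_prob_def using nonneg by (subst (asm) sum_nonneg_eq_0_iff) auto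
    with True show ?thesis by (simp add: joint_def vec_eq_iff)
  next
    case False
    then show ?thesis by (simp add: joint_def posterior_def vec_eq_iff)
  qed
  then show "?p * g (posterior S \<mu> s) = g (joint S \<mu> s)"
    using sublinear_on_orthant_scaleR[OF g p post] by simp
qed

text \<open>In the unnormalised form this is a sum of compositions of \<open>g\<close> with linear
  maps that preserve the orthant.\<close>

lemma sublinear_on_orthant_expect_posterior:
  assumes "sublinear_on_orthant g" "stochastic S"
  shows "sublinear_on_orthant (expect_posterior S g)"
  using assms unfolding sublinear_on_orthant_def[of "expect_posterior S g"]
  by (auto simp: expect_posterior_eq_sum_joint scaleR_nonneg_nonneg joint_scaleR joint_add
      joint_nonneg sublinear_on_orthant_scaleR sum_distrib_left sum.distrib[symmetric]
      intro!: sum_mono sublinear_on_orthant_add)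

lemma expect_posterior_mono:
  assumes "sublinear_on_orthant g" "sublinear_on_orthant h" "stochastic S" "0 \<le> \<mu>"
    and "\<And>x. 0 \<le> x \<Longrightarrow> g x \<le> h x"
  shows "expect_posterior S g \<mu> \<le> expect_posterior S h \<mu>"
  using assms by (simp add: expect_posterior_eq_sum_joint joint_nonneg sum_mono)

text \<open>The easy direction of Blackwell's theorem, with sublinearity in place of convexity on
  the simplex.\<close>

lemma expect_posterior_more_informative:
  assumes g: "sublinear_on_orthant g" and S: "stochastic S" and T: "stochastic T"
    and "more_informative S T" and \<mu>: "0 \<le> \<mu>"
  shows "expect_posterior T g \<mu> \<le> expect_posterior S g \<mu>"
proof -
  obtain M where M: "stochastic M" and T_eq: "T = S ** M"
    using \<open>more_informative S T\<close> unfolding more_informative_def by blast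
  have M_nonneg: "0 \<le> M $ s $ t" for s t
    using M by (simp add: stochastic_def)
  have "expect_posterior T g \<mu> = (\<Sum>t\<in>UNIV. g (\<Sum>s\<in>UNIV. M $ s $ t *\<^sub>R joint S \<mu> s))"
    by (simp add: expect_posterior_eq_sum_joint[OF g T \<mu>]) (simp add: T_eq joint_matrix_mult)
  also have "\<dots> \<le> (\<Sum>t\<in>UNIV. \<Sum>s\<in>UNIV. g (M $ s $ t *\<^sub>R joint S \<mu> s))"
    using M_nonneg joint_nonneg[OF S \<mu>]
    by (intro sum_mono sublinear_on_orthant_sum[OF g] scaleR_nonneg_nonneg) auto
  also have "\<dots> = (\<Sum>t\<in>UNIV. \<Sum>s\<in>UNIV. M $ s $ t * g (joint S \<mu> s))"
    using M_nonneg joint_nonneg[OF S \<mu>] by (simp add: sublinear_on_orthant_scaleR[OF g])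
  \<comment> \<open>After the exchange of sums, each signal of \<open>S\<close> carries a row sum of
    \<open>M\<close> as its weight.\<close>
  also have "\<dots> = (\<Sum>s\<in>UNIV. (\<Sum>t\<in>UNIV. M $ s $ t) * g (joint S \<mu> s))"
    by (subst sum.swap) (simp add: sum_distrib_right)
  also have "\<dots> = expect_posterior S g \<mu>"
    using M by (simp add: stochastic_def expect_posterior_eq_sum_joint[OF g S \<mu>])
  finally show ?thesis .
qed

lemma value_fn_last: "value_fn A u \<delta> S N N = (\<lambda>\<mu>. max (stop_payoff A u \<mu>) 0)"
  by (simp add: value_fn.simps)

lemma value_fn_step:
  "n < N \<Longrightarrow> value_fn A u \<delta> S N n = (\<lambda>\<mu>.
    max (stop_payoff A u \<mu>) (\<delta> * expect_posterior S (value_fn A u \<delta> S N (Suc n)) \<mu>))"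
  by (subst value_fn.simps) simp

lemma stop_payoff_le_value_fn: "stop_payoff A u \<mu> \<le> value_fn A u \<delta> S N n \<mu>"
  by (subst value_fn.simps) simp

lemma sublinear_on_orthant_value_fn:
  assumes "sublinear_on_orthant (stop_payoff A u)" "stochastic S" "0 \<le> \<delta>" "n \<le> N"
  shows "sublinear_on_orthant (value_fn A u \<delta> S N n)"
  using \<open>n \<le> N\<close>
proof (induction rule: inc_induct)
  case base
  show ?case
    \<comment> \<open>Zero is the only constant function that is homogeneous, so the payoff 0 for
      waiting beyond the horizon matters here.\<close>
    unfolding value_fn_last
    by (intro sublinear_on_orthant_max sublinear_on_orthant_const_zero assms(1))
next
  case (step n)
  then show ?case
    unfolding value_fn_step[OF step(2)]
    by (intro sublinear_on_orthant_max sublinear_on_orthant_cmult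
        sublinear_on_orthant_expect_posterior assms)
qed

text \<open>Stated on the orthant rather than on beliefs, because the induction hypothesis is
  applied at unnormalised posteriors.\<close>

lemma value_fn_more_informative:
  assumes \<pi>: "sublinear_on_orthant (stop_payoff A u)"
    and S: "stochastic S" and T: "stochastic T" and ST: "more_informative S T"
    and \<delta>: "0 \<le> \<delta>" and "n \<le> N" and "0 \<le> \<mu>"
  shows "value_fn A u \<delta> T N n \<mu> \<le> value_fn A u \<delta> S N n \<mu>"
  using \<open>n \<le> N\<close> \<open>0 \<le> \<mu>\<close>
proof (induction arbitrary: \<mu> rule: inc_induct)
  case base
  show ?case by (simp add: value_fn_last)
next
  case (step n)
  let ?V = "value_fn A u \<delta> S N (Suc n)" and ?U = "value_fn A u \<delta> T N (Suc n)"
  have V: "sublinear_on_orthant ?V" and U: "sublinear_on_orthant ?U"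
    using step.hyps by (auto intro!: sublinear_on_orthant_value_fn \<pi> S T \<delta>)
  \<comment> \<open>One change at a time: first the continuation value under fixed \<open>T\<close>,
    by induction, then the information structure under fixed \<open>?V\<close>.\<close>
  have "expect_posterior T ?U \<mu> \<le> expect_posterior T ?V \<mu>"
    using step by (intro expect_posterior_mono[OF U V T])
  also have "\<dots> \<le> expect_posterior S ?V \<mu>"
    using step.prems by (rule expect_posterior_more_informative[OF V S T ST])
  finally show ?case
    unfolding value_fn_step[OF step.hyps(2)] using \<delta> by (intro max.mono order_refl mult_left_mono)
qed

theorem proposition3:
  fixes A :: "'a::topological_space set"
    and u :: "'a \<Rightarrow> 'th::finite \<Rightarrow> real"
    and \<delta> :: real
    and S :: "real ^ 's::finite ^ 'th"
    and T :: "real ^ 't::finite ^ 'th"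
    and N :: nat
  assumes "CARD('th) \<ge> 2"
    and "A \<noteq> {}" and "compact A"
    and "\<And>\<theta>. bounded ((\<lambda>a. u a \<theta>) ` A)"
    and "\<And>\<theta>. continuous_on A (\<lambda>a. u a \<theta>)"
    and "0 < \<delta>" and "\<delta> \<le> 1"
    and "stochastic S" and "stochastic T"
    and "more_informative S T"
  shows "(\<forall>n\<le>N. \<forall>\<mu>\<in>beliefs. value_fn A u \<delta> S N n \<mu> \<ge> value_fn A u \<delta> T N n \<mu>) \<and>
    (\<forall>n\<le>N. acquire_set A u \<delta> T N n \<subseteq> acquire_set A u \<delta> S N n \<and>
           stop_set A u \<delta> S N n \<subseteq> stop_set A u \<delta> T N n)"
proof -
  have \<pi>: "sublinear_on_orthant (stop_payoff A u)"
    using assms(2,3,5) by (rule sublinear_on_orthant_stop_payoff)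
  have le: "value_fn A u \<delta> T N n \<mu> \<le> value_fn A u \<delta> S N n \<mu>" if "n \<le> N" "\<mu> \<in> beliefs" for n \<mu>
    using that assms(6)
    by (intro value_fn_more_informative[OF \<pi> assms(8-10)])
      (auto simp: beliefs_def less_eq_vec_def)
  have "stop_set A u \<delta> S N n \<subseteq> stop_set A u \<delta> T N n" if "n \<le> N" for n
  proof
    fix \<mu> assume "\<mu> \<in> stop_set A u \<delta> S N n"
    \<comment> \<open>The value under \<open>T\<close> is squeezed between the stopping payoff and
      the value under \<open>S\<close>, which coincide at \<open>\<mu>\<close>. Complements in
      \<open>beliefs\<close> then give the acquisition sets.\<close>
    with le[OF that, of \<mu>] stop_payoff_le_value_fn[of A u \<mu> \<delta> T N n]
    show "\<mu> \<in> stop_set A u \<delta> T N n" by (auto simp: stop_set_def)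
  qed
  with le show ?thesis unfolding acquire_set_def by blast
qed

end
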